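(* Let $L\in\{1,2\}$, ${\bf A}\in\mathbb R^{M\times N}$, ${\bf b}\in\mathbb R^M$, $\tilde\eta>0$, and let $(r,{\bf u})$ follow the weight-normalized gradient flow with $(\eta_r,\eta_{\bf u})=(\tilde\eta,1)$, $r_0>0$, ${\bf u}_0>0$. If all entries of ${\bf u}(t)$ are bounded away from zero uniformly in $t\ge0$, then $r(t)$ is bounded above uniformly in $t\ge0$.
   Context: Loss: $\mathcal L({\bf x})=\frac{1}{2L}\|{\bf A}{\bf x}^{\odot L}-{\bf b}\|_2^2$ ($\odot$ = entrywise power). Weight-normalized loss $\tilde{\mathcal L}(r,{\bf u})=\mathcal L\big(\frac{r}{\|{\bf u}\|_2}{\bf u}\big)$ for $r\in\mathbb R$, ${\bf u}\in\mathbb R^N\setminus\{0\}$. Weight-normalized gradient flow: $\partial_t r=-\eta_r\nabla_r\tilde{\mathcal L}(r,{\bf u})$, $\partial_t{\bf u}=-\eta_{\bf u}\nabla_{\bf u}\tilde{\mathcal L}(r,{\bf u})$, $r(0)=r_0$, ${\bf u}(0)={\bf u}_0$. *)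

theory Defs
  imports "HOL-Analysis.Analysis"
begin

text \<open>Entrywise power x^{\<odot>L}.\<close>
definition epow :: "real ^ 'n \<Rightarrow> nat \<Rightarrow> real ^ 'n" where
  "epow x L = (\<chi> i. (x $ i) ^ L)"

text \<open>Loss L(x) = 1/(2L) * ||A x^{\<odot>L} - b||^2.\<close>
definition loss :: "real ^ 'n ^ 'm \<Rightarrow> real ^ 'm \<Rightarrow> nat \<Rightarrow> real ^ 'n \<Rightarrow> real" where
  "loss A b L x = (1 / (2 * real L)) * (norm (A *v epow x L - b))\<^sup>2"

text \<open>Weight-normalized loss Ltilde(r,u) = L((r/||u||) u).\<close>
definition wn_loss :: "real ^ 'n ^ 'm \<Rightarrow> real ^ 'm \<Rightarrow> nat \<Rightarrow> real \<Rightarrow> real ^ 'n \<Rightarrow> real" where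
  "wn_loss A b L r u = loss A b L ((r / norm u) *\<^sub>R u)"

text \<open>(r,u) is a weight-normalized gradient flow on [0,\<infinity>) with step sizes eta_r, eta_u
  and initial data r0, u0. The gradients are the partial gradients of Ltilde
  (defined via Frechet derivatives), derivatives at t = 0 are one-sided.\<close>
definition wn_gradient_flow ::
  "real ^ 'n ^ 'm \<Rightarrow> real ^ 'm \<Rightarrow> nat \<Rightarrow> real \<Rightarrow> real \<Rightarrow> real \<Rightarrow> real ^ 'n
    \<Rightarrow> (real \<Rightarrow> real) \<Rightarrow> (real \<Rightarrow> real ^ 'n) \<Rightarrow> bool" where
  "wn_gradient_flow A b L eta_r eta_u r0 u0 r u \<longleftrightarrow>
     r 0 = r0 \<and> u 0 = u0 \<and>
     (\<forall>t\<ge>0. u t \<noteq> 0 \<and>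
        (\<exists>gr gu.
           ((\<lambda>s. wn_loss A b L s (u t)) has_real_derivative gr) (at (r t)) \<and>
           ((\<lambda>v. wn_loss A b L (r t) v) has_derivative (\<lambda>k. gu \<bullet> k)) (at (u t)) \<and>
           (r has_real_derivative (- eta_r * gr)) (at t within {0..}) \<and>
           (u has_vector_derivative (- eta_u *\<^sub>R gu)) (at t within {0..})))"

end

theory Submission
  imports Defs
begin

text \<open>Along the flow the norm of \<open>u\<close> is constant, so the effective weight
  \<open>x = (r / norm u0) u\<close> follows a gradient-like system. The residual energy
  \<open>E = norm (A x^L - p)^2\<close>, with \<open>p\<close> the projection of \<open>b\<close> onto the range of \<open>A\<close>, decays at rate
  at least \<open>2 L \<beta> r^2/(1 + r^2) norm g^2\<close>, where \<open>g\<close> is the gradient of the loss at \<open>x\<close>, while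
  \<open>|r'| \<le> \<eta> norm g\<close>. Since the entries of \<open>u\<close> stay away from zero, \<open>norm g \<ge> \<kappa> |r|^(L-1) sqrt E\<close>.
  The two weights combine to \<open>r^(L+1)/(1 + r^2)\<close>, so with \<open>G\<close> an antiderivative of that function
  \<open>\<gamma> G(r) + sqrt E\<close> is nonincreasing while \<open>E > 0\<close>; once \<open>E\<close> vanishes it stays zero and \<open>r\<close>
  freezes. As \<open>G\<close> grows linearly (\<open>L = 1\<close>) or quadratically (\<open>L = 2\<close>), this bounds \<open>r\<close>.\<close>

definition loss_grad :: "real ^ 'n ^ 'm \<Rightarrow> real ^ 'm \<Rightarrow> nat \<Rightarrow> real ^ 'n \<Rightarrow> real ^ 'n" where
  "loss_grad A b L x = (\<chi> i. (x $ i) ^ (L - 1) * ((A *v epow x L - b) v* A) $ i)"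

lemma loss_eq_sum:
  "loss A b L x = (1 / (2 * real L)) * (\<Sum>j\<in>UNIV. ((\<Sum>i\<in>UNIV. A$j$i * (x$i)^L) - b$j)^2)"
  unfolding loss_def power2_norm_eq_inner inner_vec_def
  by (simp add: matrix_vector_mult_def epow_def power2_eq_square)

lemma has_derivative_loss:
  assumes "L \<ge> 1"
  shows "(loss A b L has_derivative (\<lambda>k. loss_grad A b L x \<bullet> k)) (at x)"
proof -
  define res where "res j = (\<Sum>i\<in>UNIV. A$j$i * (x$i)^L) - b$j" for j
  have "((\<lambda>x. (1 / (2 * real L)) * (\<Sum>j\<in>UNIV. ((\<Sum>i\<in>UNIV. A$j$i * (x$i)^L) - b$j)^2)) has_derivative
     (\<lambda>k. (1 / (2 * real L)) * (\<Sum>j\<in>UNIV. 2 * res j *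
          (\<Sum>i\<in>UNIV. A$j$i * (real L * (x$i)^(L-1) * k$i))))) (at x)"
    unfolding res_def
    by (rule derivative_eq_intros bounded_linear_imp_has_derivative bounded_linear_vec_nth refl | simp)+
      (simp add: fun_eq_iff mult_ac left_diff_distrib right_diff_distrib)
  moreover have "(1 / (2 * real L)) * (\<Sum>j\<in>UNIV. 2 * res j *
          (\<Sum>i\<in>UNIV. A$j$i * (real L * (x$i)^(L-1) * k$i))) = loss_grad A b L x \<bullet> k" for k
  proof -
    have "(1 / (2 * real L)) * (\<Sum>j\<in>UNIV. 2 * res j *
          (\<Sum>i\<in>UNIV. A$j$i * (real L * (x$i)^(L-1) * k$i)))
      = (\<Sum>j\<in>UNIV. \<Sum>i\<in>UNIV. res j * (A$j$i * ((x$i)^(L-1) * k$i)))"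
      using assms by (simp add: sum_distrib_left mult_ac)
    also have "\<dots> = (\<Sum>i\<in>UNIV. \<Sum>j\<in>UNIV. res j * (A$j$i * ((x$i)^(L-1) * k$i)))"
      by (rule sum.swap)
    also have "\<dots> = loss_grad A b L x \<bullet> k"
      unfolding loss_grad_def inner_vec_def res_def
      by (simp add: matrix_vector_mult_def vector_matrix_mult_def epow_def
          sum_distrib_left sum_distrib_right algebra_simps)
    finally show ?thesis .
  qed
  ultimately show ?thesis
    unfolding loss_eq_sum[abs_def] by simp
qed

lemma has_real_derivative_wn_loss_radius:
  assumes "L \<ge> 1" "u \<noteq> 0"
  shows "((\<lambda>s. wn_loss A b L s u) has_real_derivative
           (loss_grad A b L ((r / norm u) *\<^sub>R u) \<bullet> sgn u)) (at r)"
proof -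
  let ?g = "loss_grad A b L ((r / norm u) *\<^sub>R u)"
  have "((\<lambda>s. s *\<^sub>R sgn u) has_derivative (\<lambda>h. h *\<^sub>R sgn u)) (at r)"
    by (rule bounded_linear_imp_has_derivative[OF bounded_linear_scaleR_left])
  from has_derivative_compose[OF this has_derivative_loss[OF assms(1)]]
  have "((\<lambda>s. wn_loss A b L s u) has_derivative (\<lambda>h. ?g \<bullet> (h *\<^sub>R sgn u))) (at r)"
    unfolding wn_loss_def by (simp add: sgn_div_norm divide_inverse mult.commute)
  moreover have "(\<lambda>h. ?g \<bullet> (h *\<^sub>R sgn u)) = (*) (?g \<bullet> sgn u)"
    by (auto simp: fun_eq_iff)
  ultimately show ?thesis
    by (simp add: has_field_derivative_def)
qed

lemma has_derivative_wn_loss_direction: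
  fixes A :: "real ^ 'n ^ 'm" and b :: "real ^ 'm" and r :: real and u :: "real ^ 'n"
  assumes "L \<ge> 1" "u \<noteq> 0"
  defines "g \<equiv> loss_grad A b L ((r / norm u) *\<^sub>R u)"
  shows "((\<lambda>v. wn_loss A b L r v) has_derivative
           (\<lambda>k. ((r / norm u) *\<^sub>R (g - (g \<bullet> sgn u) *\<^sub>R sgn u)) \<bullet> k)) (at u)"
proof -
  have "((\<lambda>v. (r / norm v) *\<^sub>R v) has_derivative
      (\<lambda>k. (r / norm u) *\<^sub>R k - ((r * (k \<bullet> sgn u)) / (norm u)^2) *\<^sub>R u)) (at u)"
    apply (rule has_derivative_eq_rhs)
     apply (rule has_derivative_scaleR has_derivative_divide' has_derivative_const
        has_derivative_norm[OF assms(2)] has_derivative_ident)+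
    using assms(2) by (auto simp: fun_eq_iff power2_eq_square)
  from has_derivative_compose[OF this has_derivative_loss[OF assms(1)]]
  have "((\<lambda>v. wn_loss A b L r v) has_derivative
    (\<lambda>k. g \<bullet> ((r / norm u) *\<^sub>R k - ((r * (k \<bullet> sgn u)) / (norm u)^2) *\<^sub>R u))) (at u)"
    unfolding wn_loss_def g_def .
  moreover have "g \<bullet> ((r / norm u) *\<^sub>R k - ((r * (k \<bullet> sgn u)) / (norm u)^2) *\<^sub>R u)
      = ((r / norm u) *\<^sub>R (g - (g \<bullet> sgn u) *\<^sub>R sgn u)) \<bullet> k" for k
    using assms(2) unfolding sgn_div_norm
    by (simp add: inner_diff_left inner_diff_right inner_commute power2_eq_square divide_simps)
      (simp add: right_diff_distrib mult.assoc mult.left_commute)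
  ultimately show ?thesis
    by simp
qed

lemma subspace_range_mult: "subspace (range ((*v) (A :: real^'n^'m)))"
  by (rule linear_subspace_image[OF matrix_vector_mul_linear subspace_UNIV])

lemma orthogonal_range_decomp:
  fixes A :: "real^'n^'m" and b :: "real^'m"
  shows "\<exists>p \<in> range ((*v) A). (b - p) v* A = 0"
proof -
  obtain y z where y: "y \<in> span (range ((*v) A))"
     and z: "\<And>w. w \<in> span (range ((*v) A)) \<Longrightarrow> orthogonal z w" and "b = y + z"
    using orthogonal_subspace_decomp_exists by blast
  have span: "span (range ((*v) A)) = range ((*v) A)"
    using subspace_range_mult by simp
  have "orthogonal z (A *v (z v* A))"
    using z span by auto
  then have "(z v* A) \<bullet> (z v* A) = 0"
    by (simp add: orthogonal_def dot_lmul_matrix)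
  then have "(b - y) v* A = 0"
    using \<open>b = y + z\<close> by simp
  with y span show ?thesis
    by auto
qed

lemma loss_grad_eq_of_orthogonal:
  assumes "(b - p) v* A = 0"
  shows "loss_grad A p L = loss_grad A b L"
proof -
  have "(y - p) v* A = (y - b) v* A + (b - p) v* A" for y
    by (simp add: algebra_simps)
  then have "(y - p) v* A = (y - b) v* A" for y
    using assms by simp
  then show ?thesis
    unfolding loss_grad_def by simp
qed

lemma vector_matrix_mult_bounded_below_on_range:
  fixes A :: "real^'n^'m"
  obtains \<sigma> where "\<sigma> > 0" "\<And>y. y \<in> range ((*v) A) \<Longrightarrow> \<sigma> * norm y \<le> norm (y v* A)"
proof -
  have "\<exists>e>0. \<forall>y\<in>range ((*v) A). norm (transpose A *v y) \<ge> e * norm y"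
  proof (rule injective_imp_isometric)
    show "closed (range ((*v) A))"
      by (rule closed_subspace[OF subspace_range_mult])
    show "\<forall>y\<in>range ((*v) A). transpose A *v y = 0 \<longrightarrow> y = 0"
    proof clarify
      fix w assume "transpose A *v (A *v w) = 0"
      then have "(A *v w) \<bullet> (A *v w) = 0"
        by (metis dot_lmul_matrix inner_zero_left transpose_matrix_vector)
      then show "A *v w = 0"
        by simp
    qed
  qed (rule subspace_range_mult matrix_vector_mul_bounded_linear)+
  with that show ?thesis
    by auto
qed

lemma has_real_derivative_compose_gradient:
  assumes "(f has_derivative (\<lambda>k. g \<bullet> k)) (at (x t))"
    and "(x has_vector_derivative x') (at t within S)"
  shows "((\<lambda>s. f (x s)) has_real_derivative (g \<bullet> x')) (at t within S)"
proof -
  from has_derivative_compose[OF assms(2)[unfolded has_vector_derivative_def] assms(1)]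
  have "((\<lambda>s. f (x s)) has_derivative (\<lambda>h. g \<bullet> (h *\<^sub>R x'))) (at t within S)" .
  moreover have "(\<lambda>h. g \<bullet> (h *\<^sub>R x')) = (*) (g \<bullet> x')"
    by (auto simp: fun_eq_iff)
  ultimately show ?thesis
    by (simp add: has_field_derivative_def)
qed

lemma at_within_nonneg_reals: "(t::real) > 0 \<Longrightarrow> at t within {0..} = at t"
  by (rule at_within_interior) simp

lemma nonpos_derivative_imp_le:
  fixes f :: "real \<Rightarrow> real"
  assumes "0 \<le> s" "s \<le> t" "continuous_on {s..t} f"
    and "\<And>\<tau>. s < \<tau> \<Longrightarrow> \<tau> < t \<Longrightarrow> (f has_real_derivative f' \<tau>) (at \<tau> within {0..})"
    and "\<And>\<tau>. s < \<tau> \<Longrightarrow> \<tau> < t \<Longrightarrow> f' \<tau> \<le> 0"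
  shows "f t \<le> f s"
proof (rule DERIV_nonpos_imp_decreasing_open[OF assms(2) _ assms(3)])
  fix \<tau> assume "s < \<tau>" "\<tau> < t"
  then show "\<exists>y. (f has_real_derivative y) (at \<tau>) \<and> y \<le> 0"
    using assms(1,4,5) at_within_nonneg_reals[of \<tau>] by force
qed

definition potential :: "nat \<Rightarrow> real \<Rightarrow> real" where
  "potential L r = (if L = 1 then r - arctan r else (r\<^sup>2 - ln (1 + r\<^sup>2)) / 2)"

lemma has_real_derivative_potential:
  assumes "L \<in> {1, 2}"
  shows "(potential L has_real_derivative r ^ (L + 1) / (1 + r\<^sup>2)) (at r)"
proof -
  have pos: "1 + r\<^sup>2 > 0"
    by (simp add: add_pos_nonneg)
  show ?thesis
  proof (cases "L = 1")
    case True
    have "((\<lambda>r. r - arctan r) has_real_derivative 1 - inverse (1 + r\<^sup>2)) (at r)"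
      by (rule derivative_eq_intros refl | simp)+
    moreover have "1 - inverse (1 + r\<^sup>2) = r ^ (L + 1) / (1 + r\<^sup>2)"
      using True pos by (simp add: field_simps power2_eq_square)
    ultimately show ?thesis
      using True unfolding potential_def by simp
  next
    case False
    then have "L = 2"
      using assms by auto
    have "((\<lambda>r. (r\<^sup>2 - ln (1 + r\<^sup>2)) / 2) has_real_derivative (2 * r - 2 * r / (1 + r\<^sup>2)) / 2) (at r)"
      by (rule derivative_eq_intros refl | use pos in simp)+
    moreover have "(2 * r - 2 * r / (1 + r\<^sup>2)) / 2 = r ^ (L + 1) / (1 + r\<^sup>2)"
      using \<open>L = 2\<close> pos by (simp add: field_simps power2_eq_square power3_eq_cube)
    ultimately show ?thesis
      using \<open>L = 2\<close> unfolding potential_def by simp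
  qed
qed

lemma potential_le_imp_le:
  assumes "L \<in> {1, 2}" "potential L r \<le> B"
  shows "r \<le> 4 * \<bar>B\<bar> + 3"
proof (cases "L = 1")
  case True
  then have "r - arctan r \<le> B"
    using assms(2) unfolding potential_def by simp
  moreover have "arctan r < 3"
    using arctan_ubound[of r] pi_less_4 by linarith
  ultimately show ?thesis
    by linarith
next
  case False
  then have "r\<^sup>2 - ln (1 + r\<^sup>2) \<le> 2 * B"
    using assms unfolding potential_def by auto
  moreover have "ln (1 + r\<^sup>2) \<le> r\<^sup>2 / 2 + 1"
  proof -
    have pos: "1 + r\<^sup>2 > 0"
      by (simp add: add_pos_nonneg)
    have "ln (1 + r\<^sup>2) = ln 2 + ln ((1 + r\<^sup>2) / 2)"
      using pos by (simp add: ln_div)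
    also have "ln ((1 + r\<^sup>2) / 2) \<le> (1 + r\<^sup>2) / 2 - 1"
      using pos by (intro ln_le_minus_one) simp
    also have "ln (2::real) \<le> 1"
      using ln_le_minus_one[of 2] by simp
    finally show ?thesis
      by (simp add: field_simps)
  qed
  moreover have "r \<le> 1 + r\<^sup>2"
    using zero_le_power2[of "r - 1/2"] by (simp add: power2_eq_square algebra_simps)
  ultimately show ?thesis
    by linarith
qed

lemma dissipation_lower_bound:
  fixes eta c r a G :: real
  assumes "eta > 0" "c > 0" "\<bar>a\<bar> \<le> G"
  shows "min eta (1 / c\<^sup>2) * (r\<^sup>2 / (1 + r\<^sup>2)) * G\<^sup>2 \<le> eta * a\<^sup>2 + (r / c)\<^sup>2 * (G\<^sup>2 - a\<^sup>2)"
proof -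
  define m where "m = min eta ((r / c)\<^sup>2)"
  define w where "w = r\<^sup>2 / (1 + r\<^sup>2)"
  have "0 \<le> w" "w \<le> 1" "w \<le> r\<^sup>2"
    unfolding w_def by (auto simp: add_pos_nonneg divide_le_eq_1 divide_le_eq mult_le_cancel_left1)
  then have "min eta (1 / c\<^sup>2) * w \<le> eta * 1" "min eta (1 / c\<^sup>2) * w \<le> (1 / c\<^sup>2) * r\<^sup>2"
    using assms(1,2) by (intro mult_mono; simp)+
  then have "min eta (1 / c\<^sup>2) * w \<le> m"
    unfolding m_def by (simp add: power_divide)
  moreover have "a\<^sup>2 \<le> G\<^sup>2"
    using assms(3) by (metis abs_le_square_iff abs_of_nonneg abs_ge_zero order_trans)
  ultimately have "min eta (1 / c\<^sup>2) * w * G\<^sup>2 \<le> m * G\<^sup>2"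
    by (intro mult_right_mono) auto
  also have "\<dots> = m * a\<^sup>2 + m * (G\<^sup>2 - a\<^sup>2)"
    by (simp add: algebra_simps)
  also have "\<dots> \<le> eta * a\<^sup>2 + (r / c)\<^sup>2 * (G\<^sup>2 - a\<^sup>2)"
    using \<open>a\<^sup>2 \<le> G\<^sup>2\<close> unfolding m_def by (intro add_mono mult_right_mono) auto
  finally show ?thesis
    unfolding w_def .
qed

lemma lyapunov_derivative_nonpos:
  fixes eta \<beta> \<kappa> r a G E Q :: real and L :: nat
  assumes "eta > 0" "\<beta> \<ge> 0" "\<kappa> \<ge> 0" "L \<ge> 1" "\<bar>a\<bar> \<le> G" "E > 0"
    and Q: "\<beta> * (r\<^sup>2 / (1 + r\<^sup>2)) * G\<^sup>2 \<le> Q"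
    and grad_dominates: "(\<kappa> * \<bar>r\<bar> ^ (L - 1))\<^sup>2 * E \<le> G\<^sup>2"
  shows "\<beta> * \<kappa> / eta * (r ^ (L + 1) / (1 + r\<^sup>2) * (- eta * a))
           + inverse (sqrt E) / 2 * (- 2 * real L * Q) \<le> 0"
proof -
  define M where "M = \<kappa> * \<bar>r\<bar> ^ (L - 1)"
  define w where "w = r\<^sup>2 / (1 + r\<^sup>2)"
  have "G \<ge> 0" "M \<ge> 0" "w \<ge> 0" "sqrt E > 0"
    using assms(3,5,6) unfolding M_def w_def by (simp_all add: add_pos_nonneg)
  have "(M * sqrt E)\<^sup>2 \<le> G\<^sup>2"
    using grad_dominates \<open>E > 0\<close> unfolding M_def by (simp add: power_mult_distrib)
  then have "M * sqrt E \<le> G"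
    using \<open>G \<ge> 0\<close> by (rule power2_le_imp_le)
  have "\<bar>r ^ (L + 1)\<bar> = \<bar>r\<bar> ^ (L - 1) * r\<^sup>2"
    using \<open>L \<ge> 1\<close> by (cases L) (simp_all add: abs_mult power_abs power2_eq_square)
  have "\<beta> * \<kappa> / eta * (r ^ (L + 1) / (1 + r\<^sup>2) * (- eta * a))
      \<le> \<bar>\<beta> * \<kappa> / eta * (r ^ (L + 1) / (1 + r\<^sup>2) * (- eta * a))\<bar>"
    by (rule abs_ge_self)
  also have "\<dots> = \<beta> * w * M * \<bar>a\<bar>"
    using assms(1-3) \<open>\<bar>r ^ (L + 1)\<bar> = \<bar>r\<bar> ^ (L - 1) * r\<^sup>2\<close> unfolding M_def w_def
    by (simp add: abs_mult add_pos_nonneg)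
  also have "\<dots> \<le> \<beta> * w * M * G"
    using assms(2,5) \<open>w \<ge> 0\<close> \<open>M \<ge> 0\<close> by (simp add: mult_left_mono)
  also have "\<dots> \<le> \<beta> * w * G\<^sup>2 / sqrt E"
  proof -
    have "\<beta> * w * G * (M * sqrt E) \<le> \<beta> * w * G * G"
      using \<open>M * sqrt E \<le> G\<close> \<open>G \<ge> 0\<close> \<open>w \<ge> 0\<close> assms(2) by (simp add: mult_left_mono)
    then show ?thesis
      using \<open>sqrt E > 0\<close> by (simp add: pos_le_divide_eq power2_eq_square mult_ac)
  qed
  also have "\<dots> \<le> real L * Q / sqrt E"
  proof -
    have "\<beta> * w * G\<^sup>2 \<le> Q" "0 \<le> \<beta> * w * G\<^sup>2"
      using Q assms(2) \<open>w \<ge> 0\<close> unfolding w_def by auto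
    then have "\<beta> * w * G\<^sup>2 \<le> real L * Q"
      using \<open>L \<ge> 1\<close> mult_right_mono[of 1 "real L" Q] by simp
    then show ?thesis
      using \<open>sqrt E > 0\<close> by (simp add: divide_right_mono)
  qed
  finally have "\<beta> * \<kappa> / eta * (r ^ (L + 1) / (1 + r\<^sup>2) * (- eta * a)) \<le> real L * Q / sqrt E" .
  moreover have "inverse (sqrt E) / 2 * (- 2 * real L * Q) = - (real L * Q / sqrt E)"
    by (simp add: inverse_eq_divide)
  ultimately show ?thesis
    by linarith
qed

locale wn_flow =
  fixes A :: "real ^ 'n ^ 'm" and b :: "real ^ 'm" and L :: nat and eta r0 :: real
    and u0 :: "real ^ 'n" and r :: "real \<Rightarrow> real" and u :: "real \<Rightarrow> real ^ 'n"
  assumes L_ge_1: "L \<ge> 1" and eta_pos: "eta > 0"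
    and flow: "wn_gradient_flow A b L eta 1 r0 u0 r u"
begin

definition weight :: "real \<Rightarrow> real ^ 'n" where
  "weight t = (r t / norm (u t)) *\<^sub>R u t"

definition grad :: "real \<Rightarrow> real ^ 'n" where
  "grad t = loss_grad A b L (weight t)"

definition radial :: "real \<Rightarrow> real" where
  "radial t = grad t \<bullet> sgn (u t)"

lemma u_initial: "u 0 = u0"
  using flow unfolding wn_gradient_flow_def by simp

lemma u_nonzero: "t \<ge> 0 \<Longrightarrow> u t \<noteq> 0"
  using flow unfolding wn_gradient_flow_def by auto

lemma flow_derivatives:
  assumes "t \<ge> 0"
  shows has_real_derivative_r: "(r has_real_derivative - eta * radial t) (at t within {0..})"
    and has_vector_derivative_u: "(u has_vector_derivative
          - ((r t / norm (u t)) *\<^sub>R (grad t - radial t *\<^sub>R sgn (u t)))) (at t within {0..})"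
proof -
  obtain gr gu where
        gr: "((\<lambda>s. wn_loss A b L s (u t)) has_real_derivative gr) (at (r t))"
    and gu: "((\<lambda>v. wn_loss A b L (r t) v) has_derivative (\<lambda>k. gu \<bullet> k)) (at (u t))"
    and r': "(r has_real_derivative - eta * gr) (at t within {0..})"
    and u': "(u has_vector_derivative - 1 *\<^sub>R gu) (at t within {0..})"
    using flow assms unfolding wn_gradient_flow_def by blast
  have "gr = radial t"
    using DERIV_unique[OF gr has_real_derivative_wn_loss_radius[OF L_ge_1 u_nonzero[OF assms]]]
    unfolding radial_def grad_def weight_def .
  with r' show "(r has_real_derivative - eta * radial t) (at t within {0..})"
    by simp
  have "(\<lambda>k. gu \<bullet> k) = (\<lambda>k. ((r t / norm (u t)) *\<^sub>R (grad t - radial t *\<^sub>R sgn (u t))) \<bullet> k)"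
    unfolding radial_def grad_def weight_def
    by (rule has_derivative_unique[OF gu has_derivative_wn_loss_direction[OF L_ge_1 u_nonzero[OF assms]]])
  then have "gu = (r t / norm (u t)) *\<^sub>R (grad t - radial t *\<^sub>R sgn (u t))"
    unfolding fun_eq_iff vector_eq_rdot .
  with u' show "(u has_vector_derivative
          - ((r t / norm (u t)) *\<^sub>R (grad t - radial t *\<^sub>R sgn (u t)))) (at t within {0..})"
    by simp
qed



lemma norm_u:
  assumes "t \<ge> 0"
  shows "norm (u t) = norm u0"
proof -
  have "((\<lambda>s. (norm (u s))\<^sup>2) has_real_derivative 0) (at s within {0..})" if "s \<ge> 0" for s
  proof -
    have "((\<lambda>v. (norm v)\<^sup>2) has_derivative (\<lambda>k. (2 *\<^sub>R u s) \<bullet> k)) (at (u s))"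
      using has_derivative_sqnorm_at[of "u s"] by simp
    from has_real_derivative_compose_gradient[OF this has_vector_derivative_u[OF that]]
    have deriv: "((\<lambda>s. (norm (u s))\<^sup>2) has_real_derivative
        (2 *\<^sub>R u s) \<bullet> - ((r s / norm (u s)) *\<^sub>R (grad s - radial s *\<^sub>R sgn (u s)))) (at s within {0..})" .
    have orth: "(2 *\<^sub>R u s) \<bullet> - ((r s / norm (u s)) *\<^sub>R (grad s - radial s *\<^sub>R sgn (u s))) = 0"
    proof -
      have "u s \<bullet> sgn (u s) = norm (u s)"
        using u_nonzero[OF that] by (simp add: sgn_div_norm dot_square_norm power2_eq_square)
      moreover have "radial s * norm (u s) = u s \<bullet> grad s"
        using u_nonzero[OF that] by (simp add: radial_def sgn_div_norm inner_commute)
      ultimately show ?thesis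
        by (simp add: inner_diff_right)
    qed
    from deriv show ?thesis
      unfolding orth .
  qed
  then obtain c where "\<forall>s\<in>{0..}. (norm (u s))\<^sup>2 = c"
    using has_field_derivative_zero_constant[of "{0..}" "\<lambda>s. (norm (u s))\<^sup>2"] by auto
  then have "(norm (u t))\<^sup>2 = (norm (u 0))\<^sup>2"
    using assms by simp
  moreover note u_initial
  ultimately show ?thesis
    by (simp add: power2_eq_iff_nonneg)
qed

lemma norm_u0_pos: "norm u0 > 0"
  using u_nonzero[of 0] u_initial by simp

lemma weight_eq: "t \<ge> 0 \<Longrightarrow> weight t = (r t / norm u0) *\<^sub>R u t"
  unfolding weight_def by (simp add: norm_u)

lemma has_vector_derivative_weight:
  assumes "t \<ge> 0"
  shows "(weight has_vector_derivative
           - ((r t / norm u0)\<^sup>2 *\<^sub>R (grad t - radial t *\<^sub>R sgn (u t)) + (eta * radial t / norm u0) *\<^sub>R u t))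
         (at t within {0..})"
proof -
  have "((\<lambda>s. r s / norm u0) has_real_derivative - eta * radial t / norm u0) (at t within {0..})"
    by (rule DERIV_cdivide[OF has_real_derivative_r[OF assms]])
  from has_vector_derivative_scaleR[OF this has_vector_derivative_u[OF assms]]
  have "((\<lambda>s. (r s / norm u0) *\<^sub>R u s) has_vector_derivative
           (r t / norm u0) *\<^sub>R - ((r t / norm (u t)) *\<^sub>R (grad t - radial t *\<^sub>R sgn (u t)))
           + (- eta * radial t / norm u0) *\<^sub>R u t) (at t within {0..})" .
  also have "(r t / norm u0) *\<^sub>R - ((r t / norm (u t)) *\<^sub>R (grad t - radial t *\<^sub>R sgn (u t)))
           + (- eta * radial t / norm u0) *\<^sub>R u t
      = - ((r t / norm u0)\<^sup>2 *\<^sub>R (grad t - radial t *\<^sub>R sgn (u t)) + (eta * radial t / norm u0) *\<^sub>R u t)"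
    using norm_u[OF assms] by (simp add: power2_eq_square)
  finally have "((\<lambda>s. (r s / norm u0) *\<^sub>R u s) has_vector_derivative
           - ((r t / norm u0)\<^sup>2 *\<^sub>R (grad t - radial t *\<^sub>R sgn (u t)) + (eta * radial t / norm u0) *\<^sub>R u t))
         (at t within {0..})" .
  then show ?thesis
    by (rule has_vector_derivative_transform_within[where d = 1]) (simp_all add: assms weight_eq)
qed



lemma continuous_on_r: "continuous_on {0..} r"
  using has_real_derivative_r by (intro DERIV_continuous_on) auto

text \<open>The energy is measured against the projection of \<open>b\<close> onto the range of \<open>A\<close>: this does
  not change the gradient, and on that range \<open>y \<mapsto> y v* A\<close> is bounded below.\<close>

definition proj_b :: "real ^ 'm" where
  "proj_b = (SOME p. p \<in> range ((*v) A) \<and> (b - p) v* A = 0)"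

lemma proj_b: "proj_b \<in> range ((*v) A)" "(b - proj_b) v* A = 0"
proof -
  have "\<exists>p. p \<in> range ((*v) A) \<and> (b - p) v* A = 0"
    using orthogonal_range_decomp[of A b] by blast
  from someI_ex[OF this] show "proj_b \<in> range ((*v) A)" "(b - proj_b) v* A = 0"
    unfolding proj_b_def by auto
qed

definition residual :: "real \<Rightarrow> real ^ 'm" where
  "residual t = A *v epow (weight t) L - proj_b"

definition energy :: "real \<Rightarrow> real" where
  "energy t = (norm (residual t))\<^sup>2"

definition damping :: real where
  "damping = min eta (1 / (norm u0)\<^sup>2)"

definition dissipation :: "real \<Rightarrow> real" where
  "dissipation t = eta * (radial t)\<^sup>2 + (r t / norm u0)\<^sup>2 * ((norm (grad t))\<^sup>2 - (radial t)\<^sup>2)"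

lemma grad_eq_residual: "grad t = (\<chi> i. (weight t $ i) ^ (L - 1) * (residual t v* A) $ i)"
  unfolding grad_def residual_def loss_grad_eq_of_orthogonal[OF proj_b(2), symmetric]
  by (simp add: loss_grad_def)

lemma has_real_derivative_energy:
  assumes "t \<ge> 0"
  shows "(energy has_real_derivative - 2 * real L * dissipation t) (at t within {0..})"
proof -
  have "(loss A proj_b L has_derivative (\<lambda>k. grad t \<bullet> k)) (at (weight t))"
    using has_derivative_loss[OF L_ge_1, of A proj_b "weight t"]
    unfolding grad_def loss_grad_eq_of_orthogonal[OF proj_b(2)] .
  from has_real_derivative_compose_gradient[OF this has_vector_derivative_weight[OF assms]]
  have "((\<lambda>s. loss A proj_b L (weight s)) has_real_derivative
      grad t \<bullet> - ((r t / norm u0)\<^sup>2 *\<^sub>R (grad t - radial t *\<^sub>R sgn (u t))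
                  + (eta * radial t / norm u0) *\<^sub>R u t)) (at t within {0..})" .
  also have "grad t \<bullet> - ((r t / norm u0)\<^sup>2 *\<^sub>R (grad t - radial t *\<^sub>R sgn (u t))
                  + (eta * radial t / norm u0) *\<^sub>R u t) = - dissipation t"
  proof -
    have "grad t \<bullet> u t = norm u0 * radial t"
      using norm_u[OF assms] u_nonzero[OF assms] norm_u0_pos by (simp add: radial_def sgn_div_norm)
    then have "grad t \<bullet> - ((r t / norm u0)\<^sup>2 *\<^sub>R (grad t - radial t *\<^sub>R sgn (u t))
                  + (eta * radial t / norm u0) *\<^sub>R u t)
        = - ((r t / norm u0)\<^sup>2 * (grad t \<bullet> grad t - radial t * radial t)
             + eta * radial t / norm u0 * (norm u0 * radial t))"
      by (simp add: inner_add_right inner_diff_right radial_def)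
    also have "\<dots> = - dissipation t"
      using norm_u0_pos unfolding dissipation_def power2_norm_eq_inner by (simp add: power2_eq_square)
    finally show ?thesis .
  qed
  finally have "((\<lambda>s. 2 * real L * loss A proj_b L (weight s)) has_real_derivative
      2 * real L * - dissipation t) (at t within {0..})"
    by (rule DERIV_cmult)
  moreover have "(\<lambda>s. 2 * real L * loss A proj_b L (weight s)) = energy"
    using L_ge_1 by (simp add: fun_eq_iff energy_def residual_def loss_def)
  ultimately show ?thesis
    by simp
qed

lemma continuous_on_energy: "continuous_on {0..} energy"
  using has_real_derivative_energy by (intro DERIV_continuous_on) auto

lemma radial_le_norm_grad: "t \<ge> 0 \<Longrightarrow> \<bar>radial t\<bar> \<le> norm (grad t)"
  using Cauchy_Schwarz_ineq2[of "grad t" "sgn (u t)"] u_nonzero[of t]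
  unfolding radial_def by (simp add: norm_sgn)

lemma dissipation_ge:
  "t \<ge> 0 \<Longrightarrow> damping * ((r t)\<^sup>2 / (1 + (r t)\<^sup>2)) * (norm (grad t))\<^sup>2 \<le> dissipation t"
  unfolding dissipation_def damping_def
  by (rule dissipation_lower_bound[OF eta_pos norm_u0_pos radial_le_norm_grad])

lemma damping_pos: "damping > 0"
  unfolding damping_def using eta_pos norm_u0_pos by simp

lemma dissipation_nonneg: "t \<ge> 0 \<Longrightarrow> dissipation t \<ge> 0"
  using damping_pos by (intro order_trans[OF _ dissipation_ge]) (simp_all add: add_pos_nonneg)

lemma energy_antimono:
  assumes "0 \<le> s" "s \<le> t"
  shows "energy t \<le> energy s"
proof (rule nonpos_derivative_imp_le[OF assms, where f' = "\<lambda>\<tau>. - 2 * real L * dissipation \<tau>"])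
  show "continuous_on {s..t} energy"
    using continuous_on_energy by (rule continuous_on_subset) (use assms in auto)
qed (use assms has_real_derivative_energy dissipation_nonneg in simp_all)

lemma energy_eq_0_imp_radial_eq_0:
  assumes "energy t = 0"
  shows "radial t = 0"
proof -
  have "residual t = 0"
    using assms unfolding energy_def by simp
  then have "grad t = 0"
    unfolding grad_eq_residual \<open>residual t = 0\<close> by (simp add: vec_eq_iff)
  then show ?thesis
    unfolding radial_def by simp
qed

lemma r_eq_after_energy_eq_0:
  assumes "0 \<le> s" "s \<le> t" "energy s = 0"
  shows "r t = r s"
proof -
  have "(r has_real_derivative 0) (at \<tau> within {s..})" if "\<tau> \<in> {s..}" for \<tau>
  proof -
    have "energy \<tau> = 0"
      using energy_antimono[of s \<tau>] that assms energy_def by force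
    then have "(r has_real_derivative 0) (at \<tau> within {0..})"
      using has_real_derivative_r[of \<tau>] energy_eq_0_imp_radial_eq_0 that assms(1) by simp
    then show ?thesis
      by (rule DERIV_subset) (use assms(1) in auto)
  qed
  then obtain c where "\<forall>\<tau>\<in>{s..}. r \<tau> = c"
    using has_field_derivative_zero_constant[of "{s..}" r] by auto
  then show ?thesis
    using assms(2) by simp
qed

end

locale wn_flow_bounded_below = wn_flow +
  fixes \<delta> :: real
  assumes \<delta>_pos: "\<delta> > 0" and u_entries_ge: "\<And>t i. t \<ge> 0 \<Longrightarrow> \<delta> \<le> \<bar>u t $ i\<bar>"
begin

lemma norm_grad_ge_energy:
  obtains \<kappa> where "\<kappa> > 0"
    and "\<And>t. t \<ge> 0 \<Longrightarrow> (\<kappa> * \<bar>r t\<bar> ^ (L - 1))\<^sup>2 * energy t \<le> (norm (grad t))\<^sup>2"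
proof -
  obtain \<sigma> where "\<sigma> > 0" and \<sigma>: "\<And>y. y \<in> range ((*v) A) \<Longrightarrow> \<sigma> * norm y \<le> norm (y v* A)"
    using vector_matrix_mult_bounded_below_on_range[of A] by blast
  obtain w where w: "proj_b = A *v w"
    using proj_b(1) by auto
  have "(\<sigma> * (\<delta> / norm u0) ^ (L - 1) * \<bar>r t\<bar> ^ (L - 1))\<^sup>2 * energy t \<le> (norm (grad t))\<^sup>2"
    if "t \<ge> 0" for t
  proof -
    define M where "M = \<bar>r t\<bar> ^ (L - 1) * (\<delta> / norm u0) ^ (L - 1)"
    have "M \<ge> 0"
      unfolding M_def using \<delta>_pos norm_u0_pos by simp
    have "M\<^sup>2 \<le> ((weight t $ i) ^ (L - 1))\<^sup>2" for i
    proof -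
      have "\<bar>r t\<bar> / norm u0 * \<delta> \<le> \<bar>r t\<bar> / norm u0 * \<bar>u t $ i\<bar>"
        using u_entries_ge[OF that] norm_u0_pos by (intro mult_left_mono) auto
      then have "\<bar>r t\<bar> * (\<delta> / norm u0) \<le> \<bar>weight t $ i\<bar>"
        using norm_u0_pos by (simp add: weight_eq[OF that] abs_mult)
      then have "M \<le> \<bar>weight t $ i\<bar> ^ (L - 1)"
        unfolding M_def power_mult_distrib[symmetric] using \<delta>_pos norm_u0_pos by (intro power_mono) auto
      then have "M\<^sup>2 \<le> (\<bar>weight t $ i\<bar> ^ (L - 1))\<^sup>2"
        using \<open>M \<ge> 0\<close> by (rule power_mono)
      then show ?thesis
        by (simp add: power_abs[symmetric])
    qed
    moreover have norm_sq: "(norm y)\<^sup>2 = (\<Sum>i\<in>UNIV. (y $ i)\<^sup>2)" for y :: "real ^ 'n"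
      unfolding power2_norm_eq_inner inner_vec_def by (simp add: power2_eq_square)
    ultimately have grad_ge: "M\<^sup>2 * (norm (residual t v* A))\<^sup>2 \<le> (norm (grad t))\<^sup>2"
      unfolding norm_sq sum_distrib_left grad_eq_residual
      by (intro sum_mono) (auto simp: power_mult_distrib intro: mult_right_mono)
    have "residual t \<in> range ((*v) A)"
      unfolding residual_def w by (metis matrix_vector_mult_diff_distrib rangeI)
    have "(\<sigma> * (\<delta> / norm u0) ^ (L - 1) * \<bar>r t\<bar> ^ (L - 1))\<^sup>2 * energy t
        = M\<^sup>2 * (\<sigma> * norm (residual t))\<^sup>2"
      unfolding M_def energy_def by (simp add: power_mult_distrib mult_ac)
    also have "\<dots> \<le> M\<^sup>2 * (norm (residual t v* A))\<^sup>2"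
      using \<sigma>[OF \<open>residual t \<in> range ((*v) A)\<close>] \<open>\<sigma> > 0\<close> by (intro mult_left_mono power_mono) auto
    also have "\<dots> \<le> (norm (grad t))\<^sup>2"
      by (rule grad_ge)
    finally show ?thesis .
  qed
  moreover have "\<sigma> * (\<delta> / norm u0) ^ (L - 1) > 0"
    using \<open>\<sigma> > 0\<close> \<delta>_pos norm_u0_pos by simp
  ultimately show ?thesis
    using that by blast
qed


definition lyapunov :: "real \<Rightarrow> real \<Rightarrow> real" where
  "lyapunov \<gamma> t = \<gamma> * potential L (r t) + sqrt (energy t)"

lemma continuous_on_lyapunov:
  assumes "L \<in> {1, 2}"
  shows "continuous_on {0..} (lyapunov \<gamma>)"
proof -
  have "continuous_on UNIV (potential L)"
    using has_real_derivative_potential[OF assms] by (intro DERIV_continuous_on) auto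
  then show ?thesis
    unfolding lyapunov_def
    by (intro continuous_intros continuous_on_compose2[OF _ continuous_on_r] continuous_on_energy) auto
qed

lemma lyapunov_antimono_while_energy_pos:
  assumes "L \<in> {1, 2}" "\<kappa> \<ge> 0"
    and grad_ge: "\<And>t. t \<ge> 0 \<Longrightarrow> (\<kappa> * \<bar>r t\<bar> ^ (L - 1))\<^sup>2 * energy t \<le> (norm (grad t))\<^sup>2"
    and "0 \<le> s" "s \<le> t" and energy_pos: "\<And>\<tau>. s < \<tau> \<Longrightarrow> \<tau> < t \<Longrightarrow> energy \<tau> > 0"
  shows "lyapunov (damping * \<kappa> / eta) t \<le> lyapunov (damping * \<kappa> / eta) s"
proof (rule nonpos_derivative_imp_le[OF assms(4,5), where f' = "\<lambda>\<tau>. damping * \<kappa> / eta *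
    ((r \<tau>) ^ (L + 1) / (1 + (r \<tau>)\<^sup>2) * (- eta * radial \<tau>))
    + inverse (sqrt (energy \<tau>)) / 2 * (- 2 * real L * dissipation \<tau>)"])
  show "continuous_on {s..t} (lyapunov (damping * \<kappa> / eta))"
    using continuous_on_lyapunov[OF assms(1)] by (rule continuous_on_subset) (use assms(4) in auto)
  fix \<tau> assume \<tau>: "s < \<tau>" "\<tau> < t"
  then have "\<tau> \<ge> 0"
    using assms(4) by simp
  show "(lyapunov (damping * \<kappa> / eta) has_real_derivative damping * \<kappa> / eta *
      ((r \<tau>) ^ (L + 1) / (1 + (r \<tau>)\<^sup>2) * (- eta * radial \<tau>))
      + inverse (sqrt (energy \<tau>)) / 2 * (- 2 * real L * dissipation \<tau>)) (at \<tau> within {0..})"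
    unfolding lyapunov_def[abs_def]
    by (intro DERIV_add DERIV_cmult DERIV_chain2[OF has_real_derivative_potential[OF assms(1)]]
        DERIV_chain2[OF DERIV_real_sqrt] has_real_derivative_r has_real_derivative_energy
        energy_pos \<tau> \<open>\<tau> \<ge> 0\<close>)
  show "damping * \<kappa> / eta * ((r \<tau>) ^ (L + 1) / (1 + (r \<tau>)\<^sup>2) * (- eta * radial \<tau>))
      + inverse (sqrt (energy \<tau>)) / 2 * (- 2 * real L * dissipation \<tau>) \<le> 0"
    using damping_pos
    by (intro lyapunov_derivative_nonpos[OF eta_pos _ assms(2) L_ge_1 radial_le_norm_grad
        energy_pos[OF \<tau>] dissipation_ge grad_ge] \<open>\<tau> \<ge> 0\<close>) simp_all
qed

lemma lyapunov_le_initial: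
  assumes "L \<in> {1, 2}" "\<kappa> \<ge> 0"
    and grad_ge: "\<And>t. t \<ge> 0 \<Longrightarrow> (\<kappa> * \<bar>r t\<bar> ^ (L - 1))\<^sup>2 * energy t \<le> (norm (grad t))\<^sup>2"
    and "t \<ge> 0"
  shows "lyapunov (damping * \<kappa> / eta) t \<le> lyapunov (damping * \<kappa> / eta) 0"
proof (cases "\<exists>\<tau>\<in>{0..t}. energy \<tau> = 0")
  case False
  then have "energy \<tau> > 0" if "0 < \<tau>" "\<tau> < t" for \<tau>
    using that energy_def by fastforce
  then show ?thesis
    using lyapunov_antimono_while_energy_pos[OF assms(1-3), of 0 t] assms(4) by simp
next
  case True
  define Z where "Z = {\<tau> \<in> {0..t}. energy \<tau> = 0}"
  define s where "s = Inf Z"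
  have "closed Z"
    unfolding Z_def using continuous_on_energy
    by (intro continuous_closed_preimage_constant) (auto intro: continuous_on_subset)
  moreover have "bdd_below Z"
    unfolding Z_def by (rule bdd_belowI[of _ 0]) auto
  ultimately have "s \<in> Z"
    unfolding s_def using True Z_def by (intro closed_contains_Inf) auto
  then have s: "0 \<le> s" "s \<le> t" "energy s = 0"
    unfolding Z_def by auto
  have "energy \<tau> > 0" if "0 < \<tau>" "\<tau> < s" for \<tau>
  proof -
    have "\<tau> \<notin> Z"
      using cInf_lower[OF _ \<open>bdd_below Z\<close>, of \<tau>] that unfolding s_def by force
    then show ?thesis
      using that s energy_def unfolding Z_def by force
  qed
  then have "lyapunov (damping * \<kappa> / eta) s \<le> lyapunov (damping * \<kappa> / eta) 0"
    using lyapunov_antimono_while_energy_pos[OF assms(1-3), of 0 s] s(1) by simp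
  moreover have "lyapunov (damping * \<kappa> / eta) t = lyapunov (damping * \<kappa> / eta) s"
    using r_eq_after_energy_eq_0[OF s] energy_antimono[OF s(1,2)] s(3)
    unfolding lyapunov_def energy_def by (simp add: antisym)
  ultimately show ?thesis
    by simp
qed

lemma r_bounded:
  assumes "L \<in> {1, 2}"
  shows "\<exists>C. \<forall>t\<ge>0. r t \<le> C"
proof -
  obtain \<kappa> where "\<kappa> > 0"
    and grad_ge: "\<And>t. t \<ge> 0 \<Longrightarrow> (\<kappa> * \<bar>r t\<bar> ^ (L - 1))\<^sup>2 * energy t \<le> (norm (grad t))\<^sup>2"
    using norm_grad_ge_energy by blast
  define \<gamma> where "\<gamma> = damping * \<kappa> / eta"
  have "\<gamma> > 0"
    unfolding \<gamma>_def using damping_pos \<open>\<kappa> > 0\<close> eta_pos by simp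
  have "potential L (r t) \<le> lyapunov \<gamma> 0 / \<gamma>" if "t \<ge> 0" for t
  proof -
    have "\<gamma> * potential L (r t) \<le> lyapunov \<gamma> t"
      unfolding lyapunov_def energy_def by simp
    also have "\<dots> \<le> lyapunov \<gamma> 0"
      unfolding \<gamma>_def using lyapunov_le_initial[OF assms _ grad_ge that] \<open>\<kappa> > 0\<close> by simp
    finally show ?thesis
      using \<open>\<gamma> > 0\<close> by (simp add: pos_le_divide_eq mult.commute)
  qed
  then show ?thesis
    using potential_le_imp_le[OF assms] by blast
qed

end

theorem mainTheorem14:
  fixes A :: "real ^ 'n ^ 'm" and b :: "real ^ 'm" and L :: nat
    and eta :: real and r0 :: real and u0 :: "real ^ 'n"
    and r :: "real \<Rightarrow> real" and u :: "real \<Rightarrow> real ^ 'n"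
  assumes "L \<in> {1, 2}"
    and "eta > 0"
    and "r0 > 0"
    and "\<forall>i. u0 $ i > 0"
    and "wn_gradient_flow A b L eta 1 r0 u0 r u"
    and "\<exists>\<delta>>0. \<forall>t\<ge>0. \<forall>i. \<bar>u t $ i\<bar> \<ge> \<delta>"
  shows "\<exists>C. \<forall>t\<ge>0. r t \<le> C"
proof -
  obtain \<delta> where "\<delta> > 0" and "\<forall>t\<ge>0. \<forall>i. \<bar>u t $ i\<bar> \<ge> \<delta>"
    using assms(6) by blast
  then interpret wn_flow_bounded_below A b L eta r0 u0 r u \<delta>
    using assms(1,2,5) by unfold_locales auto
  show ?thesis
    using r_bounded[OF assms(1)] .
qed

end
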